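(* For every finite simple graph $G$, \[ \delta(G)\alpha(G) \le \Delta(G)\mu(G), \] and this inequality is sharp (equality holds for some graphs with $\delta(G) \ge 1$).
   Context: $\delta(G)$ and $\Delta(G)$ denote the minimum and maximum vertex degrees of $G$; $\alpha(G)$ is the independence number and $\mu(G)$ the matching number (maximum size of a matching) of $G$. *)

theory Defs
  imports Main
begin

locale fin_simple_graph =
  fixes V :: "'a set" and E :: "'a set set"
  assumes finite_verts: "finite V"
    and edges: "e \<in> E \<Longrightarrow> e \<subseteq> V \<and> card e = 2"

definition degree :: "'a set set \<Rightarrow> 'a \<Rightarrow> nat" where
  "degree E v = card {e \<in> E. v \<in> e}"

text \<open>On the graph without vertices the next two values are \<open>Min {}\<close> and \<open>Max {}\<close>,
  about which nothing is known.\<close>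

definition min_degree :: "'a set \<Rightarrow> 'a set set \<Rightarrow> nat" where
  "min_degree V E = Min (degree E ` V)"

definition max_degree :: "'a set \<Rightarrow> 'a set set \<Rightarrow> nat" where
  "max_degree V E = Max (degree E ` V)"

definition independent :: "'a set \<Rightarrow> 'a set set \<Rightarrow> 'a set \<Rightarrow> bool" where
  "independent V E S \<longleftrightarrow> S \<subseteq> V \<and> (\<forall>u\<in>S. \<forall>v\<in>S. {u, v} \<notin> E)"

definition independence_number :: "'a set \<Rightarrow> 'a set set \<Rightarrow> nat" where
  "independence_number V E = Max (card ` {S. independent V E S})"

definition matching :: "'a set set \<Rightarrow> 'a set set \<Rightarrow> bool" where
  "matching E M \<longleftrightarrow> M \<subseteq> E \<and> pairwise disjnt M"

definition matching_number :: "'a set set \<Rightarrow> nat" where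
  "matching_number E = Max (card ` {M. matching E M})"

end

theory Submission
  imports Defs
begin

text \<open>Let \<open>S\<close> be a maximum independent set. Every edge at a vertex of \<open>S\<close> leaves \<open>S\<close>, so double
  counting gives \<open>\<delta> |X| \<le> \<Delta> |N(X)|\<close> for all \<open>X \<subseteq> S\<close>. By the defect form of Hall's theorem some
  \<open>X \<subseteq> S\<close> and some matching \<open>M\<close> satisfy \<open>|M| \<ge> |N(X)| + |S - X|\<close>, whence
  \<open>\<Delta> |M| \<ge> \<delta> |X| + \<delta> |S - X| = \<delta> |S|\<close>. Equality holds for a single edge.\<close>

text \<open>Rado's argument: if \<open>x\<close> has two neighbours, submodularity of \<open>X \<mapsto> |R `` X|\<close> shows that one of
  the two pairs can be dropped. Once no such \<open>x\<close> is left, \<open>R\<close> is single-valued on \<open>S\<close>.\<close>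

lemma hall_defect:
  fixes R :: "('a \<times> 'b) set"
  assumes "finite R" and "finite S"
    and "\<And>X. X \<subseteq> S \<Longrightarrow> m \<le> card (R `` X) + card (S - X)"
  shows "\<exists>M\<subseteq>R. M \<subseteq> S \<times> UNIV \<and> inj_on fst M \<and> inj_on snd M \<and> m \<le> card M"
  using assms(1,3)
proof (induction R rule: finite_psubset_induct)
  case (psubset R)
  note fin = \<open>finite R\<close> \<open>finite S\<close>
  show ?case
  proof (cases "\<exists>x\<in>S. \<exists>y z. (x, y) \<in> R \<and> (x, z) \<in> R \<and> y \<noteq> z")
    case True
    then obtain x y z where x: "x \<in> S" "(x, y) \<in> R" "(x, z) \<in> R" "y \<noteq> z" by blast
    \<comment> \<open>If the hypothesis survives the deletion of one pair at \<open>x\<close>,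
      induction on the smaller relation finishes.\<close>
    have step: ?thesis
      if "(x, w) \<in> R" and "\<And>X. X \<subseteq> S \<Longrightarrow> m \<le> card ((R - {(x, w)}) `` X) + card (S - X)" for w
    proof -
      have "R - {(x, w)} \<subset> R" using that(1) by blast
      from psubset.IH[OF this that(2)] show ?thesis by blast
    qed
    show ?thesis
    proof (rule ccontr)
      assume "\<not> ?thesis"
      with step x obtain X Y where
        X: "X \<subseteq> S" "card ((R - {(x, y)}) `` X) + card (S - X) < m" and
        Y: "Y \<subseteq> S" "card ((R - {(x, z)}) `` Y) + card (S - Y) < m"
        by (meson not_le)
      define A B where "A = (R - {(x, y)}) `` X" and "B = (R - {(x, z)}) `` Y"
      \<comment> \<open>Deleting a pair at \<open>x\<close> only affects images of sets containing
        \<open>x\<close>, so a set that violates the bound afterwards contains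
        \<open>x\<close>.\<close>
      have "x \<in> X"
      proof (rule ccontr)
        assume "x \<notin> X"
        then have "(R - {(x, y)}) `` X = R `` X" by blast
        with X psubset.prems[of X] show False by simp
      qed
      moreover have "x \<in> Y"
      proof (rule ccontr)
        assume "x \<notin> Y"
        then have "(R - {(x, z)}) `` Y = R `` Y" by blast
        with Y psubset.prems[of Y] show False by simp
      qed
      \<comment> \<open>The pair deleted on one side survives on the other, so the union loses
        nothing. Images of points other than \<open>x\<close> are untouched by both
        deletions.\<close>
      ultimately have un: "R `` (X \<union> Y) \<subseteq> A \<union> B" and int: "R `` (X \<inter> Y - {x}) \<subseteq> A \<inter> B"
        using \<open>y \<noteq> z\<close> by (auto simp: A_def B_def)
      have finAB: "finite A" "finite B"
        unfolding A_def B_def using fin by (auto intro: finite_Image)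
      have finXY: "finite X" "finite Y" using X(1) Y(1) fin finite_subset by blast+
      have "m \<le> card (A \<union> B) + card (S - (X \<union> Y))"
        using psubset.prems[of "X \<union> Y"] X(1) Y(1) card_mono[OF _ un] finAB by fastforce
      \<comment> \<open>Dropping \<open>x\<close> from \<open>X \<inter> Y\<close> costs the extra
        1. This is still enough: the two strict violations sum to at most 2m - 2, the two lower
        bounds to at least 2m - 1.\<close>
      moreover have "m \<le> card (A \<inter> B) + card (S - (X \<inter> Y)) + 1"
      proof -
        have "S - (X \<inter> Y - {x}) = insert x (S - (X \<inter> Y))"
          using \<open>x \<in> S\<close> by blast
        moreover have "card (insert x (S - (X \<inter> Y))) \<le> card (S - (X \<inter> Y)) + 1"
          using fin by (simp add: card_insert_if)
        ultimately have "card (S - (X \<inter> Y - {x})) \<le> card (S - (X \<inter> Y)) + 1" by simp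
        moreover have "m \<le> card (R `` (X \<inter> Y - {x})) + card (S - (X \<inter> Y - {x}))"
          using X(1) by (intro psubset.prems) blast
        moreover have "card (R `` (X \<inter> Y - {x})) \<le> card (A \<inter> B)"
          using finAB by (intro card_mono int) simp
        ultimately show ?thesis by linarith
      qed
      moreover have "card A + card B = card (A \<union> B) + card (A \<inter> B)"
        using finAB by (rule card_Un_Int)
      moreover have "card (S - X) + card (S - Y) = card (S - (X \<union> Y)) + card (S - (X \<inter> Y))"
        using card_Un_Int[of "S - X" "S - Y"] fin by (simp add: Diff_Int Diff_Un)
      ultimately show False using X(2) Y(2) by (simp flip: A_def B_def)
    qed
  next
    case False
    have "\<forall>y\<in>R `` S. \<exists>x\<in>S. (x, y) \<in> R" by blast
    then obtain g where g: "\<And>y. y \<in> R `` S \<Longrightarrow> g y \<in> S \<and> (g y, y) \<in> R" by metis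
    \<comment> \<open>Each point of \<open>S\<close> now has at most one image, so distinct
      \<open>y\<close> get distinct \<open>g y\<close>. The hypothesis for the whole of
      \<open>S\<close> then bounds the size of \<open>M\<close>.\<close>
    define M where "M = (\<lambda>y. (g y, y)) ` (R `` S)"
    have "inj_on fst M"
    proof (rule inj_onI)
      fix p q assume "p \<in> M" "q \<in> M" "fst p = fst q"
      then obtain y z where "y \<in> R `` S" "z \<in> R `` S" "p = (g y, y)" "q = (g z, z)" "g y = g z"
        unfolding M_def by force
      then show "p = q" using False g[of y] g[of z] by auto
    qed
    moreover have "inj_on snd M" "M \<subseteq> R" "M \<subseteq> S \<times> UNIV"
      using g by (auto simp: M_def inj_on_def)
    moreover have "m \<le> card M"
    proof -
      have "card M = card (R `` S)"
        unfolding M_def by (intro card_image) (auto simp: inj_on_def)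
      then show ?thesis using psubset.prems[of S] by simp
    qed
    ultimately show ?thesis by (intro exI[of _ M] conjI)
  qed
qed

text \<open>Count the pairs of \<open>R\<close> that start in \<open>X\<close>: each point of
  \<open>X\<close> starts at least \<open>d\<close> of them, each point of the image ends at most
  \<open>D\<close>.\<close>

lemma card_mult_le_card_Image_mult:
  fixes R :: "('a \<times> 'b) set"
  assumes "finite R" and "finite X"
    and "\<And>x. x \<in> X \<Longrightarrow> d \<le> card (R `` {x})"
    and "\<And>y. y \<in> R `` X \<Longrightarrow> card (R\<inverse> `` {y}) \<le> D"
  shows "d * card X \<le> D * card (R `` X)"
proof -
  have fin: "finite (R `` X)" using assms(1) by (rule finite_Image)
  have fib: "R `` {x} = {y \<in> R `` X. (x, y) \<in> R}" if "x \<in> X" for x using that by blast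
  have "d * card X = (\<Sum>x\<in>X. d)" by simp
  also have "\<dots> \<le> (\<Sum>x\<in>X. card {y \<in> R `` X. (x, y) \<in> R})"
    by (intro sum_mono) (metis assms(3) fib)
  also have "\<dots> = (\<Sum>y\<in>R `` X. card {x \<in> X. (x, y) \<in> R})"
    by (rule sum_multicount_gen) (use assms fin in auto)
  also have "\<dots> \<le> (\<Sum>y\<in>R `` X. D)"
  proof (intro sum_mono)
    fix y assume "y \<in> R `` X"
    have "card {x \<in> X. (x, y) \<in> R} \<le> card (R\<inverse> `` {y})"
      using assms(1) by (intro card_mono finite_Image) auto
    also have "\<dots> \<le> D" using assms(4) \<open>y \<in> R `` X\<close> .
    finally show "card {x \<in> X. (x, y) \<in> R} \<le> D" .
  qed
  finally show ?thesis by (simp add: mult.commute)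
qed

context fin_simple_graph
begin

lemma finite_edges: "finite E"
  using edges finite_verts by (intro finite_subset[of E "Pow V"]) auto

lemma edge_verts:
  assumes "{x, y} \<in> E" shows "x \<in> V" "y \<in> V" "x \<noteq> y"
  using edges[OF assms] by auto

text \<open>An edge through \<open>v\<close> has exactly one other end. This turns degrees into
  sizes of images under a relation, as the double counting needs.\<close>

lemma degree_eq_card_neighbours: "degree E v = card {w. {v, w} \<in> E}"
proof -
  have "{e \<in> E. v \<in> e} = (\<lambda>w. {v, w}) ` {w. {v, w} \<in> E}" (is "?L = ?f ` ?N")
  proof
    show "?L \<subseteq> ?f ` ?N"
    proof
      fix e assume e: "e \<in> ?L"
      then have "card e = 2" using edges by blast
      then obtain a b where "e = {a, b}" by (meson card_2_iff)
      with e show "e \<in> ?f ` ?N" by (auto simp: insert_commute)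
    qed
  qed auto
  moreover have "inj_on ?f ?N" by (auto simp: inj_on_def doubleton_eq_iff)
  ultimately show ?thesis by (simp add: degree_def card_image)
qed

lemma min_degree_le: "v \<in> V \<Longrightarrow> min_degree V E \<le> degree E v"
  unfolding min_degree_def using finite_verts by simp

lemma degree_le_max_degree: "v \<in> V \<Longrightarrow> degree E v \<le> max_degree V E"
  unfolding max_degree_def using finite_verts by simp

lemma card_matching_le: "matching E M \<Longrightarrow> card M \<le> matching_number E"
  unfolding matching_number_def using finite_edges
  by (intro Max_ge finite_imageI finite_subset[of "{M. matching E M}" "Pow E"])
    (auto simp: matching_def)

lemma ex_maximum_independent:
  obtains S where "independent V E S" and "card S = independence_number V E"
proof -
  have fin: "finite {S. independent V E S}"
    using finite_verts by (intro finite_subset[of "{S. independent V E S}" "Pow V"]) (auto simp: independent_def)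
  have "independent V E {}" by (simp add: independent_def)
  then have "independence_number V E \<in> card ` {S. independent V E S}"
    unfolding independence_number_def using fin by (intro Max_in) auto
  then obtain S where "independent V E S" "card S = independence_number V E" by force
  then show ?thesis by (rule that)
qed

lemma card_independent_bound:
  assumes "independent V E S"
  shows "min_degree V E * card S \<le> max_degree V E * matching_number E"
\<comment> \<open>A nonempty \<open>S\<close> provides a vertex, without which
  \<open>min_degree\<close> and \<open>max_degree\<close> are unspecified and could not be
  compared.\<close>
proof (cases "S = {}")
  case False
  have SV: "S \<subseteq> V" and indep: "\<And>x y. x \<in> S \<Longrightarrow> y \<in> S \<Longrightarrow> {x, y} \<notin> E"
    using assms by (auto simp: independent_def)
  have finS: "finite S" using SV finite_verts finite_subset by blast
  define R where "R = {(x, y). x \<in> S \<and> {x, y} \<in> E}"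
  have "R \<subseteq> V \<times> V" using edge_verts by (auto simp: R_def)
  then have finR: "finite R" using finite_verts finite_subset by blast
  let ?c = "\<lambda>X. card (R `` X) + card (S - X)"
  \<comment> \<open>A minimiser of \<open>?c\<close> makes \<open>?c X\<close> itself an admissible
    \<open>m\<close> in \<open>hall_defect\<close>.\<close>
  obtain X where X: "X \<subseteq> S" "\<And>Y. Y \<subseteq> S \<Longrightarrow> ?c X \<le> ?c Y"
    using ex_has_least_nat[of "\<lambda>X. X \<subseteq> S" "{}" ?c] by auto
  obtain M where M: "M \<subseteq> R" "inj_on fst M" "inj_on snd M" "?c X \<le> card M"
    using hall_defect[OF finR finS X(2)] by blast
  let ?f = "\<lambda>(x, y). {x, y}"
  have cross: "x \<in> S \<and> y \<notin> S \<and> {x, y} \<in> E" if "(x, y) \<in> M" for x y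
    using that M(1) indep by (auto simp: R_def)
  \<comment> \<open>First components lie in \<open>S\<close> and second ones outside, so a common
    vertex of two edges sits in the same coordinate of both pairs. This yields both disjointness of
    the edges and injectivity of \<open>?f\<close>.\<close>
  have eq: "p = q" if "p \<in> M" "q \<in> M" "?f p \<inter> ?f q \<noteq> {}" for p q
  proof -
    have "fst p = fst q \<or> snd p = snd q"
      using that cross[of "fst p" "snd p"] cross[of "fst q" "snd q"]
      by (auto simp: case_prod_unfold)
    then show ?thesis using that M(2,3) by (auto dest: inj_onD)
  qed
  have "matching E (?f ` M)"
    unfolding matching_def
  proof
    show "?f ` M \<subseteq> E" using cross by auto
    show "pairwise disjnt (?f ` M)"
    proof (intro pairwiseI)
      fix e e' assume "e \<in> ?f ` M" "e' \<in> ?f ` M" "e \<noteq> e'"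
      then obtain p q where pq: "p \<in> M" "q \<in> M" "e = ?f p" "e' = ?f q" by (elim imageE)
      with \<open>e \<noteq> e'\<close> have "p \<noteq> q" by metis
      then have "?f p \<inter> ?f q = {}" using eq[OF pq(1,2)] by argo
      then show "disjnt e e'" unfolding disjnt_def pq(3,4) .
    qed
  qed
  moreover have "card (?f ` M) = card M"
  proof (intro card_image inj_onI)
    fix p q assume "p \<in> M" "q \<in> M" "?f p = ?f q"
    then show "p = q" using eq[of p q] by (auto simp: case_prod_unfold)
  qed
  ultimately have "card M \<le> matching_number E"
    using card_matching_le by metis
  with M(4) have mu: "?c X \<le> matching_number E" by linarith
  have finX: "finite X" using X(1) finS finite_subset by blast
  have "min_degree V E * card X \<le> max_degree V E * card (R `` X)"
  proof (rule card_mult_le_card_Image_mult[OF finR finX])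
    fix x assume "x \<in> X"
    then have "R `` {x} = {w. {x, w} \<in> E}" "x \<in> V" using X(1) SV by (auto simp: R_def)
    then show "min_degree V E \<le> card (R `` {x})"
      using min_degree_le by (simp add: degree_eq_card_neighbours)
  next
    fix y assume "y \<in> R `` X"
    then have "y \<in> V" using edge_verts by (auto simp: R_def)
    have "{w. {y, w} \<in> E} \<subseteq> V" using edge_verts by auto
    \<comment> \<open>Only an inequality, since \<open>y\<close> may have neighbours outside
      \<open>S\<close>.\<close>
    then have "card (R\<inverse> `` {y}) \<le> degree E y"
      unfolding degree_eq_card_neighbours using finite_verts
      by (intro card_mono) (auto simp: R_def insert_commute dest: finite_subset)
    also have "\<dots> \<le> max_degree V E" using \<open>y \<in> V\<close> by (rule degree_le_max_degree)
    finally show "card (R\<inverse> `` {y}) \<le> max_degree V E" .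
  qed
  \<comment> \<open>For the points outside \<open>X\<close>, comparing both extremes with the degree
    of any one vertex suffices.\<close>
  moreover have "min_degree V E * card (S - X) \<le> max_degree V E * card (S - X)"
  proof (rule mult_le_mono1)
    obtain v where "v \<in> V" using False SV by blast
    then show "min_degree V E \<le> max_degree V E"
      using min_degree_le degree_le_max_degree le_trans by blast
  qed
  moreover have "card S = card X + card (S - X)"
    using card_Diff_subset[OF finX X(1)] card_mono[OF finS X(1)] by simp
  ultimately have "min_degree V E * card S \<le> max_degree V E * ?c X"
    by (metis distrib_left add_mono)
  also have "\<dots> \<le> max_degree V E * matching_number E" using mu by (rule mult_le_mono2)
  finally show ?thesis .
qed simp

end

text \<open>The witness for sharpness: with all four parameters equal to 1, both sides are
  1.\<close>

lemma single_edge_parameters: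
  fixes u v :: 'a
  assumes "u \<noteq> v"
  defines "V \<equiv> {u, v}" and "E \<equiv> {{u, v}}"
  shows "fin_simple_graph V E" and "min_degree V E = 1" and "max_degree V E = 1"
    and "independence_number V E = 1" and "matching_number E = 1"
proof -
  show "fin_simple_graph V E"
    using \<open>u \<noteq> v\<close> by unfold_locales (auto simp: V_def E_def)
  have "{e \<in> E. w \<in> e} = E" if "w \<in> V" for w using that by (auto simp: V_def E_def)
  then have "degree E ` V = {1}" by (force simp: degree_def V_def E_def)
  then show "min_degree V E = 1" "max_degree V E = 1"
    by (simp_all add: min_degree_def max_degree_def)
  \<comment> \<open>Independence also tests \<open>{u, u}\<close>, which differs from the edge
    because the ends are distinct; so singletons qualify.\<close>
  have "{S. independent V E S} = {{}, {u}, {v}}"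
    using \<open>u \<noteq> v\<close> by (auto simp: independent_def V_def E_def doubleton_eq_iff)
  then show "independence_number V E = 1" by (simp add: independence_number_def)
  have "{M. matching E M} = {{}, {{u, v}}}"
    by (auto simp: matching_def E_def subset_singleton_iff)
  then show "matching_number E = 1" by (simp add: matching_number_def)
qed

theorem theorem2:
  "(\<forall>(V :: 'a set) E. fin_simple_graph V E \<longrightarrow>
      min_degree V E * independence_number V E \<le> max_degree V E * matching_number E) \<and>
   (\<exists>(V :: nat set) E. fin_simple_graph V E \<and> V \<noteq> {} \<and> min_degree V E \<ge> 1 \<and>
      min_degree V E * independence_number V E = max_degree V E * matching_number E)"
proof (intro conjI allI impI)
  fix V :: "'a set" and E
  assume "fin_simple_graph V E"
  then interpret fin_simple_graph V E .
  show "min_degree V E * independence_number V E \<le> max_degree V E * matching_number E"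
    by (metis ex_maximum_independent card_independent_bound)
next
  show "\<exists>(V :: nat set) E. fin_simple_graph V E \<and> V \<noteq> {} \<and> min_degree V E \<ge> 1 \<and>
      min_degree V E * independence_number V E = max_degree V E * matching_number E"
    \<comment> \<open>The type \<open>nat\<close> supplies two distinct vertices, which an arbitrary
      type need not have.\<close>
    using single_edge_parameters[of "0::nat" 1]
    by (intro exI[of _ "{0, 1}"] exI[of _ "{{0, 1}}"]) simp
qed

end
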